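(* If $X$ is a cellular subset of $\mathbb{R}^n$ then there exists a homeomorphism $h:\mathbb{R}^n\to\mathbb{R}^n$ such that $h(x)=x$ for all $x\in X$ and $X$ is the global attractor for the dynamical system generated by $h$. Moreover, if $X\subset B(0,R)$, there exists a constant $\rho>0$ such that $h(B(0,r))\subset B(0,r-\rho)$ for every $r\ge R$.
   Context: $B(0,r)$ denotes the open Euclidean ball in $\mathbb{R}^n$ of radius $r$ centred at the origin. A set $X\subset\mathbb{R}^n$ is cellular if $X=\bigcap_{j=1}^\infty C_j$, where each $C_j\subset\mathbb{R}^n$ is a cell, i.e. is homeomorphic to the closed unit ball of $\mathbb{R}^n$, and $C_{j+1}\subset\operatorname{int}(C_j)$ for all $j$. The dynamical system generated by $h$ is given by the iterates $h^m$ of $h$. A set $\mathbb{A}$ is a global attractor for a continuous map $h:\mathbb{R}^n\to\mathbb{R}^n$ if $\mathbb{A}$ is compact, $h(\mathbb{A})=\mathbb{A}$, and for every bounded $B\subset\mathbb{R}^n$, $\operatorname{dist}(h^m(B),\mathbb{A})\to0$ as $m\to\infty$, where $\operatorname{dist}(A,B)=\sup_{a\in A}\inf_{b\in B}|a-b|$; if it exists, the global attractor is unique. *)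

theory Defs
  imports "HOL-Analysis.Analysis"
begin

definition cell :: "'a::euclidean_space set \<Rightarrow> bool" where
  "cell C \<longleftrightarrow> C homeomorphic (cball 0 1 :: 'a set)"

definition cellular :: "'a::euclidean_space set \<Rightarrow> bool" where
  "cellular X \<longleftrightarrow>
     (\<exists>C :: nat \<Rightarrow> 'a set.
        (\<forall>j. cell (C j)) \<and> (\<forall>j. C (Suc j) \<subseteq> interior (C j)) \<and> X = (\<Inter>j. C j))"

text \<open>The values are extended nonnegative reals, so that the supremum and the infimum exist for
  all sets; in particular the supremum over the empty set is \<open>0\<close> and the infimum over it is
  \<open>\<infinity>\<close>.\<close>

definition semidist :: "'a::metric_space set \<Rightarrow> 'a set \<Rightarrow> ennreal" where
  "semidist A B = (SUP a\<in>A. INF b\<in>B. ennreal (dist a b))"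

definition global_attractor :: "('a::euclidean_space \<Rightarrow> 'a) \<Rightarrow> 'a set \<Rightarrow> bool" where
  "global_attractor h A \<longleftrightarrow>
     continuous_on UNIV h \<and> compact A \<and> h ` A = A \<and>
     (\<forall>B. bounded B \<longrightarrow> (\<lambda>m. semidist ((h ^^ m) ` B) A) \<longlonglongrightarrow> 0)"

end

theory Submission
  imports Defs
begin

text \<open>Squeezing inside the cells around \<open>X\<close> yields homeomorphisms of the space that carry ever smaller
  balls around \<open>0\<close> onto ever smaller neighbourhoods of \<open>X\<close>, each differing from its predecessor only
  on the last ball. Off \<open>0\<close> they are locally eventually constant, so their limit is a
  homeomorphism \<open>F\<close> from the complement of \<open>0\<close> onto the complement of \<open>X\<close>, equal to the identity far
  away. Let \<open>s\<close> be a homeomorphism pulling every point radially towards \<open>0\<close> and take \<open>h\<close> to be the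
  conjugate of \<open>s\<close> by \<open>F\<close> off \<open>X\<close> and the identity on \<open>X\<close>. Nothing forces \<open>F\<close> to extend
  continuously to \<open>0\<close>, so \<open>h\<close> is continuous on \<open>X\<close> only if the steps of \<open>s\<close> near \<open>0\<close> are so small
  that \<open>F (s p)\<close> and \<open>F p\<close> become arbitrarily close as \<open>p\<close> tends to \<open>0\<close>.\<close>

section \<open>Self-homeomorphisms of Euclidean space\<close>

definition self_homeo :: "('a::euclidean_space \<Rightarrow> 'a) \<Rightarrow> bool" where
  "self_homeo f \<longleftrightarrow> continuous_on UNIV f \<and> bij f"

lemma self_homeo_bij: "self_homeo f \<Longrightarrow> bij f"
  by (simp add: self_homeo_def)

lemma self_homeo_continuous_on: "self_homeo f \<Longrightarrow> continuous_on S f"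
  unfolding self_homeo_def using continuous_on_subset by blast

lemma self_homeo_id: "self_homeo id"
  by (simp add: self_homeo_def)

lemma self_homeo_compose: "self_homeo f \<Longrightarrow> self_homeo g \<Longrightarrow> self_homeo (f \<circ> g)"
  unfolding self_homeo_def
  by (meson bij_comp continuous_on_compose continuous_on_subset subset_UNIV)

text \<open>Invariance of domain supplies continuity of the inverse, which is why
  \<open>self_homeo\<close> can be phrased with continuity and bijectivity alone.\<close>

lemma self_homeo_homeomorphism:
  assumes "self_homeo f"
  shows "homeomorphism UNIV UNIV f (inv f)"
proof -
  have b: "bij f" and c: "continuous_on UNIV f"
    using assms by (auto simp: self_homeo_def)
  obtain g where g: "homeomorphism UNIV (f ` UNIV) f g"
    using invariance_of_domain_homeomorphism[OF open_UNIV c] bij_is_inj[OF b] by auto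
  then have "inv f = g"
    using b unfolding homeomorphism_def
    by (metis UNIV_I bij_is_inj ext inv_f_f bij_is_surj)
  then show ?thesis
    using g b by (simp add: bij_is_surj)
qed

lemma self_homeo_inv: "self_homeo f \<Longrightarrow> self_homeo (inv f)"
  using self_homeo_homeomorphism[of f]
  by (simp add: self_homeo_def bij_imp_bij_inv homeomorphism_def)

lemma self_homeo_open_image:
  assumes "self_homeo f" "open S"
  shows "open (f ` S)"
  using invariance_of_domain[OF self_homeo_continuous_on[OF assms(1)] assms(2)]
    bij_is_inj[OF self_homeo_bij[OF assms(1)]] inj_on_subset by blast

lemma homeomorphism_imp_self_homeo: "homeomorphism UNIV UNIV f g \<Longrightarrow> self_homeo f"
  unfolding homeomorphism_def self_homeo_def by (metis UNIV_I bij_def inj_on_inverseI)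

section \<open>Squeezing inside a cell\<close>

text \<open>The map keeps directions and acts on norms by r -> r^(a+1), a bijection of [0,1];
  preimages come from the (a+1)-th root.\<close>

lemma bij_betw_norm_power_scale_cball:
  "bij_betw (\<lambda>x::'a::real_normed_vector. norm x ^ a *\<^sub>R x) (cball 0 1) (cball 0 1)"
  (is "bij_betw ?s _ _")
proof (rule bij_betw_imageI)
  have nrm: "norm (?s x) = norm x ^ Suc a" for x :: 'a
    by simp
  show "inj_on ?s (cball 0 1)"
  proof (rule inj_onI)
    fix x y :: 'a
    assume eq: "?s x = ?s y"
    then have "norm x ^ Suc a = norm y ^ Suc a"
      using nrm by metis
    then have "norm x = norm y"
      by (metis norm_ge_zero power_inject_base)
    then show "x = y"
      using eq by (cases "x = 0") auto
  qed
  show "?s ` cball 0 1 = cball 0 1"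
  proof
    show "?s ` cball 0 1 \<subseteq> cball 0 1"
      using nrm by (auto simp: power_le_one mult_le_one)
    show "cball 0 1 \<subseteq> ?s ` cball 0 1"
    proof
      fix y :: 'a
      assume y: "y \<in> cball 0 1"
      show "y \<in> ?s ` cball 0 1"
      proof (cases "y = 0")
        case False
        define r where "r = root (Suc a) (norm y)"
        have r: "r ^ Suc a = norm y" "0 \<le> r" "r \<le> 1"
          using y False unfolding r_def
          by (auto simp del: power_Suc intro: real_root_pow_pos2)
        have "?s ((r / norm y) *\<^sub>R y) = y"
          using r False by (simp add: power_commutes)
        moreover have "(r / norm y) *\<^sub>R y \<in> cball 0 1"
          using r False by simp
        ultimately show ?thesis
          by (rule image_eqI[OF sym])
      qed (auto intro: image_eqI[of _ _ 0])
    qed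
  qed
qed

text \<open>In the coordinates of the cell, \<open>x \<mapsto> \<bar>x\<bar>\<^sup>a x\<close> fixes the boundary sphere and, for large \<open>a\<close>,
  squeezes \<open>K\<close> into \<open>V\<close>; \<open>\<theta>\<close> is the inverse of this map.\<close>

lemma cell_engulf:
  fixes D :: "'a::euclidean_space set"
  assumes "cell D"
  obtains q where "q \<in> interior D"
    and "\<And>K V. \<lbrakk>compact K; K \<subseteq> interior D; open V; q \<in> V\<rbrakk>
      \<Longrightarrow> \<exists>\<theta>. self_homeo \<theta> \<and> (\<forall>x. x \<notin> D \<longrightarrow> \<theta> x = x) \<and> K \<subseteq> \<theta> ` V"
proof -
  obtain \<psi> \<phi> where "homeomorphism D (cball (0::'a) 1) \<psi> \<phi>"
    using assms unfolding cell_def homeomorphic_def by (elim exE)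
  then have hom: "homeomorphism (cball 0 1) D \<phi> \<psi>"
    by (rule iffD1[OF homeomorphism_sym])
  note c\<phi> = homeomorphism_cont1[OF hom] and c\<psi> = homeomorphism_cont2[OF hom]
    and im = homeomorphism_image1[OF hom] homeomorphism_image2[OF hom]
    and \<psi>\<phi> = homeomorphism_apply1[OF hom] and \<phi>\<psi> = homeomorphism_apply2[OF hom]
  have inj\<phi>: "inj_on \<phi> (cball 0 1)" and inj\<psi>: "inj_on \<psi> D"
    by (metis inj_on_inverseI \<psi>\<phi>) (metis inj_on_inverseI \<phi>\<psi>)
  have "compact D"
    using c\<phi> im(1) by (metis compact_cball compact_continuous_image)
  \<comment> \<open>Invariance of domain, applied here to \<open>\<phi>\<close> and below to
    \<open>\<psi>\<close>, matches the interior of \<open>D\<close> with the open ball.\<close>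
  have "open (\<phi> ` ball 0 1)"
    by (rule invariance_of_domain)
      (use c\<phi> inj\<phi> ball_subset_cball in \<open>auto intro: continuous_on_subset inj_on_subset\<close>)
  then have ball: "\<phi> ` ball 0 1 \<subseteq> interior D"
    using im(1) ball_subset_cball by (intro interior_maximal) blast+
  have "open (\<psi> ` interior D)"
    by (rule invariance_of_domain)
      (use c\<psi> inj\<psi> interior_subset in \<open>auto intro: continuous_on_subset inj_on_subset\<close>)
  then have int: "\<psi> ` interior D \<subseteq> ball 0 1"
    using im(2) interior_subset by (metis image_mono interior_cball interior_maximal)
  show ?thesis
  proof (rule that)
    show "\<phi> 0 \<in> interior D"
      using ball by force
    fix K V :: "'a set"
    assume K: "compact K" "K \<subseteq> interior D" and V: "open V" "\<phi> 0 \<in> V"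
    have "compact (\<psi> ` K)"
      using K c\<psi> interior_subset
      by (metis compact_continuous_image continuous_on_subset)
    have "\<exists>\<rho>. 0 \<le> \<rho> \<and> \<rho> < 1 \<and> \<psi> ` K \<subseteq> cball 0 \<rho>"
    proof (cases "K = {}")
      case True
      then show ?thesis by (intro exI[of _ 0]) auto
    next
      case False
      then obtain z where z: "z \<in> \<psi> ` K" "\<And>x. x \<in> \<psi> ` K \<Longrightarrow> norm x \<le> norm z"
        using continuous_attains_sup[OF \<open>compact (\<psi> ` K)\<close> _ continuous_on_norm_id] by auto
      then have "norm z < 1"
        using int K(2) by force
      then show ?thesis
        using z by (intro exI[of _ "norm z"]) auto
    qed
    then obtain \<rho> where \<rho>: "0 \<le> \<rho>" "\<rho> < 1" "\<psi> ` K \<subseteq> cball 0 \<rho>"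
      by blast
    obtain \<delta> where \<delta>: "\<delta> > 0" "\<And>x. x \<in> cball 0 1 \<Longrightarrow> norm x < \<delta> \<Longrightarrow> \<phi> x \<in> V"
    proof -
      obtain e where e: "e > 0" "ball (\<phi> 0) e \<subseteq> V"
        using V open_contains_ball by blast
      moreover obtain d where "d > 0" "\<And>x. x \<in> cball 0 1 \<Longrightarrow> dist x 0 < d \<Longrightarrow> dist (\<phi> x) (\<phi> 0) < e"
        using c\<phi> e(1) unfolding continuous_on_iff by (metis centre_in_cball zero_le_one)
      ultimately show ?thesis
        by (intro that[of d]) (auto simp: dist_commute subset_iff)
    qed
    \<comment> \<open>Points of norm at most \<open>\<rho>\<close> are scaled to norm at most
      \<open>\<rho> ^ a\<close>, so \<open>K\<close> lands where \<open>\<phi>\<close> takes values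
      in \<open>V\<close>.\<close>
    obtain a where a: "\<rho> ^ a < \<delta>"
      using real_arch_pow_inv \<delta>(1) \<rho>(2) by blast
    define s where "s = (\<lambda>x::'a. norm x ^ a *\<^sub>R x)"
    define \<tau> where "\<tau> = (\<lambda>y. if y \<in> D then \<phi> (s (\<psi> y)) else y)"
    have s: "bij_betw s (cball 0 1) (cball 0 1)"
      unfolding s_def by (rule bij_betw_norm_power_scale_cball)
    have "bij_betw (\<phi> \<circ> (s \<circ> \<psi>)) D D"
      by (rule bij_betw_trans[OF bij_betw_trans[OF _ s]])
        (use inj\<phi> inj\<psi> im in \<open>simp_all only: bij_betw_def\<close>)
    then have "bij_betw \<tau> D D"
      by (rule iffD1[OF bij_betw_cong, rotated]) (simp add: \<tau>_def)
    moreover have "bij_betw \<tau> (-D) (-D)"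
      using bij_betw_id by (rule iffD1[OF bij_betw_cong, rotated]) (simp add: \<tau>_def)
    ultimately have "bij \<tau>"
      using bij_betw_combine[of \<tau> D D "-D" "-D"] by (simp add: Compl_partition)
    \<comment> \<open>A boundary point of \<open>D\<close> has coordinates on the unit sphere, where
      \<open>s\<close> is the identity; hence the two branches of \<open>\<tau>\<close> agree on the
      overlap and paste continuously.\<close>
    have fr: "\<phi> (s (\<psi> y)) = y" if "y \<in> D" "y \<in> closure (- D)" for y
    proof -
      have "y \<notin> interior D"
        using that(2) by (simp add: closure_complement)
      then have "\<psi> y \<notin> ball 0 1"
        using ball \<phi>\<psi> that(1) by (metis imageI subsetD)
      then have "norm (\<psi> y) = 1"
        using im(2) that(1) by force
      then show ?thesis
        using \<phi>\<psi> that(1) by (simp add: s_def)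
    qed
    have cs: "continuous_on (cball 0 1) s"
      unfolding s_def by (intro continuous_intros)
    have "continuous_on D (\<lambda>y. \<phi> (s (\<psi> y)))"
      using s im(2)
      by (intro continuous_on_compose2[OF c\<phi>] continuous_on_compose2[OF cs] c\<psi>)
        (auto simp: bij_betw_def)
    then have "continuous_on (D \<union> closure (-D)) \<tau>"
      unfolding \<tau>_def using \<open>compact D\<close> fr closure_subset[of "-D"]
      by (intro continuous_on_cases) (auto simp: compact_imp_closed)
    moreover have "D \<union> closure (-D) = UNIV"
      using closure_subset[of "-D"] by auto
    ultimately have \<tau>: "self_homeo \<tau>"
      using \<open>bij \<tau>\<close> by (simp add: self_homeo_def)
    have \<tau>K: "\<tau> y \<in> V" if "y \<in> K" for y
    proof -
      have y: "y \<in> D"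
        using that K(2) interior_subset by blast
      have n: "norm (\<psi> y) \<le> \<rho>" "norm (\<psi> y) \<le> 1"
        using that \<rho> by force+
      have "norm (s (\<psi> y)) \<le> norm (\<psi> y) ^ a"
        using n by (simp add: s_def mult_left_le)
      also have "\<dots> \<le> \<rho> ^ a"
        using n by (simp add: power_mono)
      finally have "norm (s (\<psi> y)) < \<delta>"
        using a by simp
      moreover have "s (\<psi> y) \<in> cball 0 1"
        using bij_betwE[OF s] im(2) y by blast
      ultimately show ?thesis
        using \<delta>(2) y by (simp add: \<tau>_def)
    qed
    show "\<exists>\<theta>. self_homeo \<theta> \<and> (\<forall>x. x \<notin> D \<longrightarrow> \<theta> x = x) \<and> K \<subseteq> \<theta> ` V"
    proof (intro exI conjI allI impI subsetI)
      show "self_homeo (inv \<tau>)"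
        by (rule self_homeo_inv[OF \<tau>])
      show "inv \<tau> x = x" if "x \<notin> D" for x
        using that \<open>bij \<tau>\<close> by (metis \<tau>_def bij_is_inj inv_f_f)
      show "y \<in> inv \<tau> ` V" if "y \<in> K" for y
        using \<tau>K[OF that] \<open>bij \<tau>\<close> by (metis bij_is_inj imageI inv_f_f)
    qed
  qed
qed

section \<open>Cells and cellular sets\<close>

lemma cell_compact: "cell C \<Longrightarrow> compact C"
  by (auto simp: cell_def dest: homeomorphic_compactness)

lemma cell_nonempty: "cell C \<Longrightarrow> C \<noteq> {}"
  by (auto simp: cell_def homeomorphic_empty)

lemma
  fixes X :: "'a::euclidean_space set"
  assumes "cellular X"
  shows cellular_compact: "compact X"
    and cellular_nonempty: "X \<noteq> {}"
    and cellular_neighbourhood: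
      "\<And>W. \<lbrakk>open W; X \<subseteq> W\<rbrakk> \<Longrightarrow> \<exists>D. cell D \<and> X \<subseteq> interior D \<and> D \<subseteq> W"
proof -
  obtain C :: "nat \<Rightarrow> 'a set" where C: "\<And>j. cell (C j)"
    and CS: "\<And>j. C (Suc j) \<subseteq> interior (C j)" and X: "X = (\<Inter>j. C j)"
    using assms unfolding cellular_def by blast
  have cpt: "compact (C j)" for j
    by (rule cell_compact[OF C])
  have mono: "m \<le> n \<Longrightarrow> C n \<subseteq> C m" for m n
    using CS interior_subset by (metis lift_Suc_antimono_le order_trans)
  show "compact X"
    unfolding X by (rule compact_Inter) (use cpt in auto)
  show "X \<noteq> {}"
    unfolding X by (rule compact_nest) (use cpt C cell_nonempty mono in auto)
  fix W
  assume W: "open W" "X \<subseteq> W"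
  have "\<exists>j. C j \<subseteq> W"
  proof (rule ccontr)
    assume "\<nexists>j. C j \<subseteq> W"
    \<comment> \<open>Decreasing nonempty compact sets have a common point, which here would be a
      point of \<open>X\<close> outside \<open>W\<close>.\<close>
    then have "(\<Inter>j. C j - W) \<noteq> {}"
      by (intro compact_nest) (use cpt W mono in \<open>auto simp: compact_diff\<close>, metis subsetD)
    then show False
      using W X by auto
  qed
  then obtain j where "C j \<subseteq> W" ..
  moreover have "X \<subseteq> interior (C j)"
    using X CS by blast
  ultimately show "\<exists>D. cell D \<and> X \<subseteq> interior D \<and> D \<subseteq> W"
    using C by blast
qed

section \<open>The homeomorphism from the complement of the origin onto the complement of
  \<open>X\<close>\<close>

text \<open>Take a cell \<open>D\<close> around \<open>X\<close> inside both \<open>W\<close> and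
  the image of the old ball. Engulfing starts only from neighbourhoods of the special point
  \<open>q\<close>, so \<open>0\<close> is first moved, within the old ball, to the preimage of
  \<open>q\<close>. A tiny ball around \<open>0\<close> is then mapped into \<open>D\<close>, and
  \<open>\<theta>\<close> stretches its image over \<open>X\<close> without leaving
  \<open>D\<close>.\<close>

lemma shrink_step:
  fixes X :: "'a::euclidean_space set"
  assumes X: "cellular X" and G: "self_homeo G" and XG: "X \<subseteq> G ` ball 0 t"
    and W: "open W" "X \<subseteq> W" and "t > 0"
  obtains G' t' where "self_homeo G'" "0 < t'" "t' \<le> t / 2"
    "\<And>x. norm x \<ge> t \<Longrightarrow> G' x = G x" "X \<subseteq> G' ` ball 0 t'" "G' ` cball 0 t' \<subseteq> W"
proof -
  have "open (W \<inter> G ` ball 0 t)"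
    using W self_homeo_open_image[OF G] by auto
  then obtain D where D: "cell D" "X \<subseteq> interior D" "D \<subseteq> W" "D \<subseteq> G ` ball 0 t"
    using cellular_neighbourhood[OF X, of "W \<inter> G ` ball 0 t"] W XG by auto
  obtain q where q: "q \<in> interior D"
    and engulf: "\<And>K V. \<lbrakk>compact K; K \<subseteq> interior D; open V; q \<in> V\<rbrakk>
      \<Longrightarrow> \<exists>\<theta>. self_homeo \<theta> \<and> (\<forall>x. x \<notin> D \<longrightarrow> \<theta> x = x) \<and> K \<subseteq> \<theta> ` V"
    using cell_engulf[OF D(1)] by blast
  obtain q' where q': "q' \<in> ball 0 t" "G q' = q"
    using q D(4) interior_subset by blast
  have aff: "affine hull (ball (0::'a) t) = UNIV"
    using \<open>t > 0\<close> by (simp add: affine_hull_open)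
  obtain \<sigma> \<sigma>' where \<sigma>: "homeomorphism UNIV UNIV \<sigma> \<sigma>'" "\<sigma> (0::'a) = q'"
      "{x. \<not> (\<sigma> x = x \<and> \<sigma>' x = x)} \<subseteq> ball 0 t"
    using homeomorphism_moving_point[of "ball 0 t" UNIV 0 q'] aff q'(1) \<open>t > 0\<close>
    by (simp add: convex_connected del: de_Morgan_conj) blast
  define G1 where "G1 = G \<circ> \<sigma>"
  have G1: "self_homeo G1"
    unfolding G1_def by (intro self_homeo_compose G homeomorphism_imp_self_homeo[OF \<sigma>(1)])
  have "G1 0 = q"
    by (simp add: G1_def \<sigma> q')
  have G1out: "G1 x = G x" if "norm x \<ge> t" for x
  proof -
    have "x \<notin> ball 0 t"
      using that by simp
    then have "\<sigma> x = x"
      using \<sigma>(3) by blast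
    then show ?thesis
      by (simp add: G1_def)
  qed
  have "open (G1 -` interior D)"
    using self_homeo_continuous_on[OF G1] continuous_on_open_vimage[of UNIV G1] by auto
  moreover have "0 \<in> G1 -` interior D"
    using q \<open>G1 0 = q\<close> by simp
  ultimately obtain e where e: "e > 0" "cball 0 e \<subseteq> G1 -` interior D"
    using open_contains_cball by blast
  define t' where "t' = min e (t / 2)"
  have t': "0 < t'" "t' \<le> t / 2" "G1 ` cball 0 t' \<subseteq> interior D"
    using e \<open>t > 0\<close> by (auto simp: t'_def)
  obtain \<theta> where \<theta>: "self_homeo \<theta>" "\<And>x. x \<notin> D \<Longrightarrow> \<theta> x = x" "X \<subseteq> \<theta> ` (G1 ` ball 0 t')"
    using engulf[OF cellular_compact[OF X] D(2) self_homeo_open_image[OF G1 open_ball], of 0 t']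
      \<open>G1 0 = q\<close> t'(1) by (metis centre_in_ball imageI)
  \<comment> \<open>A bijection that fixes every point outside \<open>D\<close> cannot carry a point
    of \<open>D\<close> out of it.\<close>
  have \<theta>D: "\<theta> x \<in> D" if "x \<in> D" for x
    using \<theta>(2) that self_homeo_bij[OF \<theta>(1)] by (metis bij_pointE)
  show ?thesis
  proof (rule that)
    show "self_homeo (\<theta> \<circ> G1)"
      by (intro self_homeo_compose \<theta> G1)
    show "0 < t'" "t' \<le> t / 2"
      by (fact t')+
    show "(\<theta> \<circ> G1) x = G x" if "norm x \<ge> t" for x
    proof -
      have "G x \<notin> G ` ball 0 t"
        using that bij_is_inj[OF self_homeo_bij[OF G]] by (auto simp: inj_image_mem_iff)
      then show ?thesis
        using D(4) \<theta>(2) G1out[OF that] by auto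
    qed
    show "X \<subseteq> (\<theta> \<circ> G1) ` ball 0 t'"
      using \<theta>(3) by (simp add: image_comp)
    show "(\<theta> \<circ> G1) ` cball 0 t' \<subseteq> W"
      using t'(3) \<theta>D D(3) interior_subset by fastforce
  qed
qed

text \<open>The last two conclusions stand in for continuity at \<open>0\<close> and on
  \<open>X\<close>: small punctured balls around \<open>0\<close> go into small neighbourhoods of
  \<open>X\<close>, and \<open>F'\<close> sends points near \<open>X\<close> close to
  \<open>0\<close>.\<close>

lemma cellular_complement_homeomorphism:
  fixes X :: "'a::euclidean_space set"
  assumes X: "cellular X" and XR: "X \<subseteq> ball 0 R"
  obtains F F' where "homeomorphism (- {0}) (- X) F F'"
    "\<And>x. norm x \<ge> R \<Longrightarrow> F x = x"
    "\<And>\<epsilon>. \<epsilon> > 0 \<Longrightarrow> \<exists>\<delta>>0. \<forall>x. x \<noteq> 0 \<and> norm x < \<delta> \<longrightarrow> infdist (F x) X < \<epsilon>"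
    "\<And>\<delta>. \<delta> > 0 \<Longrightarrow> \<exists>U. open U \<and> X \<subseteq> U \<and> (\<forall>y\<in>U - X. norm (F' y) < \<delta>)"
proof -
  have X0: "X \<noteq> {}" and "compact X"
    using X by (rule cellular_nonempty, rule cellular_compact)
  then have R: "R > 0"
    using XR by (metis ball_empty linorder_not_le subset_empty)
  define W where "W = (\<lambda>k::nat. {y. infdist y X < inverse (real (Suc k))})"
  have W: "open (W k)" "X \<subseteq> W k" for k
    unfolding W_def by (auto intro!: open_Collect_less continuous_intros)
  \<comment> \<open>\<open>P\<close> is the invariant of stage \<open>n\<close> and \<open>Q\<close>
    relates consecutive stages. The bound \<open>R / 2 ^ n\<close> forces the radii to 0.\<close>
  define P where "P = (\<lambda>(n::nat) (G :: 'a \<Rightarrow> 'a, t). self_homeo G \<and> 0 < t \<and> t \<le> R / 2 ^ n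
    \<and> X \<subseteq> G ` ball 0 t \<and> (\<forall>x. norm x \<ge> R \<longrightarrow> G x = x))"
  define Q where "Q = (\<lambda>n (G :: 'a \<Rightarrow> 'a, t) (G' :: 'a \<Rightarrow> 'a, t').
    t' \<le> t \<and> (\<forall>x. norm x \<ge> t \<longrightarrow> G' x = G x) \<and> G' ` cball 0 t' \<subseteq> W n)"
  have "\<exists>f. \<forall>n. P n (f n) \<and> Q n (f n) (f (Suc n))"
  proof (rule dependent_nat_choice)
    show "\<exists>x. P 0 x"
      unfolding P_def using R XR self_homeo_id by (intro exI[of _ "(id, R)"]) auto
    fix x :: "('a \<Rightarrow> 'a) \<times> real" and n
    assume Px: "P n x"
    obtain G t where x: "x = (G, t)" by fastforce
    have G: "self_homeo G" "X \<subseteq> G ` ball 0 t" "t > 0" "t \<le> R / 2 ^ n"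
      "\<And>x. norm x \<ge> R \<Longrightarrow> G x = x"
      using Px unfolding P_def x by auto
    obtain G' t' where G': "self_homeo G'" "0 < t'" "t' \<le> t / 2"
      "\<And>x. norm x \<ge> t \<Longrightarrow> G' x = G x" "X \<subseteq> G' ` ball 0 t'" "G' ` cball 0 t' \<subseteq> W n"
      using shrink_step[OF X G(1,2) W[of n] G(3)] by blast
    have "R / 2 ^ n \<le> R"
      using R by (simp add: pos_divide_le_eq)
    then have "t \<le> R"
      using G(4) by simp
    moreover have "t' \<le> R / 2 ^ Suc n"
      using G'(3) G(4) by simp
    ultimately have "P (Suc n) (G', t') \<and> Q n x (G', t')"
      unfolding P_def Q_def x using G' G(3,5) by auto
    then show "\<exists>y. P (Suc n) y \<and> Q n x y" ..
  qed
  then obtain f where f: "\<And>n. P n (f n)" "\<And>n. Q n (f n) (f (Suc n))"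
    by blast
  define G where "G = (\<lambda>n. fst (f n))"
  define t where "t = (\<lambda>n. snd (f n))"
  have G: "self_homeo (G n)" and t0: "0 < t n" and tR: "t n \<le> R / 2 ^ n"
    and XG: "X \<subseteq> G n ` ball 0 (t n)" and GR: "\<And>x. norm x \<ge> R \<Longrightarrow> G n x = x" for n
    using f(1)[of n] by (auto simp: P_def G_def t_def split_beta)
  have tS: "t (Suc n) \<le> t n" and GS: "\<And>x. norm x \<ge> t n \<Longrightarrow> G (Suc n) x = G n x"
    and GW: "G (Suc n) ` cball 0 (t (Suc n)) \<subseteq> W n" for n
    using f(2)[of n] by (auto simp: Q_def G_def t_def split_beta)
  have injG: "inj (G n)" for n
    using G self_homeo_bij bij_is_inj by blast
  have tmono: "t n \<le> t m" if "m \<le> n" for m n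
    using that tS by (rule lift_Suc_antimono_le[rotated])
  have tsmall: "\<exists>n. t n < \<delta>" if "\<delta> > 0" for \<delta>
  proof -
    obtain n where "(1/2) ^ n < \<delta> / R"
      using real_arch_pow_inv[of "\<delta> / R" "1/2"] \<open>\<delta> > 0\<close> R by auto
    then have "R / 2 ^ n < \<delta>"
      using R by (simp add: field_simps power_one_over)
    then show ?thesis
      using tR order_le_less_trans by blast
  qed
  have Gstab: "G n x = G m x" if "m \<le> n" "norm x \<ge> t m" for m n x
    using that
  proof (induction n rule: dec_induct)
    case (step n)
    then show ?case
      using GS[of n x] tmono[of m n] by simp
  qed simp
  \<comment> \<open>Both maps are bijections that agree off the ball, so they have the same image of
    the ball.\<close>
  have Gball: "G n ` ball 0 (t m) = G m ` ball 0 (t m)" if "m \<le> n" for m n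
  proof -
    have "G n ` (- ball 0 (t m)) = G m ` (- ball 0 (t m))"
      by (rule image_cong) (use Gstab[OF that] in auto)
    then show ?thesis
      using bij_image_Compl_eq[OF self_homeo_bij[OF G]] by (metis double_compl)
  qed
  txt \<open>By \<open>Gstab\<close> the sequence \<open>G n x\<close> is eventually constant for \<open>x \<noteq> 0\<close>; \<open>F\<close> is its limit.\<close>
  define F where "F = (\<lambda>x. G (LEAST k. t k \<le> norm x) x)"
  have F: "F x = G k x" if "t k \<le> norm x" for k x
    unfolding F_def using that
    by (intro Gstab[symmetric]) (auto intro: Least_le LeastI)
  have Fball: "F x \<in> G k ` ball 0 (t k) \<longleftrightarrow> norm x < t k" if "x \<noteq> 0" for x k
  proof (cases "norm x < t k")
    case True
    obtain n where "t n < norm x"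
      using tsmall \<open>x \<noteq> 0\<close> by (meson zero_less_norm_iff)
    then have "t (max n k) \<le> norm x"
      using tmono[of n "max n k"] by simp
    then have "F x \<in> G (max n k) ` ball 0 (t k)"
      using F True by auto
    then show ?thesis
      using Gball[of k "max n k"] True by simp
  next
    case False
    then show ?thesis
      using F[of k x] inj_image_mem_iff[OF injG] by simp
  qed
  \<comment> \<open>These open sets exhaust the punctured space, and \<open>F\<close> coincides with
    the single map \<open>G k\<close> on the k-th of them.\<close>
  have un: "- {0} = (\<Union>k. - cball (0::'a) (t k))"
    using tsmall t0 by (auto simp: not_le) (metis zero_less_norm_iff, metis less_asym)
  have contF: "continuous_on (- {0}) F"
    unfolding un
  proof (rule continuous_on_open_UN)
    fix k
    have "G k x = F x" if "x \<in> - cball 0 (t k)" for x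
      using F[of k x] that by simp
    then show "continuous_on (- cball 0 (t k)) F"
      using self_homeo_continuous_on[OF G] by (rule continuous_on_eq[rotated])
  qed auto
  have injF: "inj_on F (- {0})"
  proof (rule inj_onI)
    fix x y
    assume xy: "x \<in> - {0}" "y \<in> - {0}" "F x = F y"
    then obtain k where "t k < min (norm x) (norm y)"
      using tsmall[of "min (norm x) (norm y)"] by auto
    then have "F x = G k x" "F y = G k y"
      by (auto intro: F)
    with xy(3) show "x = y"
      using injG by (metis injD)
  qed
  have imF: "F ` (- {0}) = - X"
  proof
    show "F ` (- {0}) \<subseteq> - X"
    proof clarsimp
      fix x :: 'a
      assume "x \<noteq> 0" "F x \<in> X"
      moreover obtain k where "t k < norm x"
        using tsmall \<open>x \<noteq> 0\<close> by (meson zero_less_norm_iff)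
      ultimately show False
        using Fball[of x k] XG[of k] by auto
    qed
    \<comment> \<open>A point off \<open>X\<close> misses some \<open>W k\<close>, so its preimage
      under \<open>G (Suc k)\<close> lies outside the ball of radius \<open>t (Suc k)\<close>, where
      that map already equals \<open>F\<close>.\<close>
    show "- X \<subseteq> F ` (- {0})"
    proof
      fix y
      assume "y \<in> - X"
      then have "infdist y X > 0"
        using infdist_pos_not_in_closed[OF compact_imp_closed[OF \<open>compact X\<close>] X0] by simp
      then obtain k where "inverse (real (Suc k)) < infdist y X"
        using reals_Archimedean by blast
      then have "y \<notin> W k"
        by (simp add: W_def)
      moreover obtain x where x: "y = G (Suc k) x"
        using self_homeo_bij[OF G] by (meson bij_pointE)
      ultimately have "norm x > t (Suc k)"
        using GW[of k] by force
      then have "y = F x" "x \<noteq> 0"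
        using F[of "Suc k" x] x t0[of "Suc k"] by auto
      then show "y \<in> F ` (- {0})"
        by blast
    qed
  qed
  obtain F' where F': "homeomorphism (- {0}) (- X) F F'"
    using invariance_of_domain_homeomorphism[OF _ contF _ injF] imF by auto
  show ?thesis
  proof (rule that)
    show "homeomorphism (- {0}) (- X) F F'"
      by (fact F')
    show "F x = x" if "norm x \<ge> R" for x
      using that F[of 0 x] GR[of x 0] tR[of 0] by simp
    show "\<exists>\<delta>>0. \<forall>x. x \<noteq> 0 \<and> norm x < \<delta> \<longrightarrow> infdist (F x) X < \<epsilon>" if "\<epsilon> > 0" for \<epsilon>
    proof -
      obtain k where k: "inverse (real (Suc k)) < \<epsilon>"
        using reals_Archimedean \<open>\<epsilon> > 0\<close> by blast
      have "infdist (F x) X < \<epsilon>" if "x \<noteq> 0" "norm x < t (Suc k)" for x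
      proof -
        have "F x \<in> W k"
          using Fball[of x "Suc k"] that GW[of k] ball_subset_cball[of 0 "t (Suc k)"] by blast
        then show ?thesis
          using k by (simp add: W_def)
      qed
      then show ?thesis
        using t0 by blast
    qed
    show "\<exists>U. open U \<and> X \<subseteq> U \<and> (\<forall>y\<in>U - X. norm (F' y) < \<delta>)" if "\<delta> > 0" for \<delta>
    proof -
      obtain k where k: "t k < \<delta>"
        using tsmall \<open>\<delta> > 0\<close> by blast
      have "norm (F' y) < \<delta>" if "y \<in> G k ` ball 0 (t k)" "y \<notin> X" for y
      proof -
        have "F' y \<noteq> 0" "F (F' y) = y"
          using F' that(2) unfolding homeomorphism_def by (blast, simp)
        then show ?thesis
          using Fball[of "F' y" k] that(1) k by simp
      qed
      then show ?thesis
        using self_homeo_open_image[OF G open_ball] XG by (intro exI[of _ "G k ` ball 0 (t k)"]) auto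
    qed
  qed
qed

section \<open>Radial contractions with a variable step length\<close>

text \<open>Here \<open>e x\<close> is the distance by which \<open>x\<close> is pulled towards
  \<open>0\<close>. A Lipschitz constant below 1 makes the remaining radius strictly increasing
  along each ray, and \<open>le_half\<close> keeps nonzero points from reaching
  \<open>0\<close>.\<close>

locale radial_contraction =
  fixes e :: "'a::euclidean_space \<Rightarrow> real"
  assumes lipschitz: "\<bar>e x - e y\<bar> \<le> dist x y / 2"
    and pos: "x \<noteq> 0 \<Longrightarrow> 0 < e x"
    and le_half: "e x \<le> norm x / 2"
    and zero: "e 0 = 0"
begin

lemma e_less: "x \<noteq> 0 \<Longrightarrow> e x < norm x"
  using le_half[of x] zero_less_norm_iff[of x] by linarith

definition shrink :: "'a \<Rightarrow> 'a" where
  "shrink x = x - e x *\<^sub>R sgn x"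

lemma shrink_eq_scaleR_sgn: "shrink x = (norm x - e x) *\<^sub>R sgn x"
  by (cases "x = 0") (simp_all add: shrink_def sgn_div_norm algebra_simps)

lemma norm_shrink: "x \<noteq> 0 \<Longrightarrow> norm (shrink x) = norm x - e x"
  using e_less[of x] by (simp add: shrink_eq_scaleR_sgn norm_sgn)

lemma shrink_0: "shrink 0 = 0"
  by (simp add: shrink_def)

lemma norm_shrink_le: "norm (shrink x) \<le> norm x"
  using norm_shrink[of x] pos[of x] shrink_0 by (cases "x = 0") auto

lemma dist_shrink: "x \<noteq> 0 \<Longrightarrow> dist x (shrink x) = e x"
  using pos[of x] by (simp add: shrink_def dist_norm norm_sgn)

lemma shrink_eq_0_iff: "shrink x = 0 \<longleftrightarrow> x = 0"
proof (cases "x = 0")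
  case False
  then have "norm (shrink x) > 0"
    using e_less[of x] norm_shrink[of x] by simp
  then show ?thesis
    using False by auto
qed (simp add: shrink_0)

lemma sgn_shrink: "sgn (shrink x) = sgn x"
proof (cases "x = 0")
  case False
  then have "norm x - e x > 0"
    using e_less[of x] by simp
  moreover have "sgn (sgn x) = sgn x"
    using False by (simp add: sgn_div_norm)
  ultimately show ?thesis
    by (simp add: shrink_eq_scaleR_sgn sgn_scaleR)
qed (simp add: shrink_0)

lemma continuous_on_e: "continuous_on S e"
proof (rule continuous_on_subset[OF _ subset_UNIV])
  show "continuous_on UNIV e"
    unfolding continuous_on_iff
  proof (intro ballI allI impI)
    fix x :: 'a and \<epsilon> :: real
    assume "0 < \<epsilon>"
    then show "\<exists>d>0. \<forall>y\<in>UNIV. dist y x < d \<longrightarrow> dist (e y) (e x) < \<epsilon>"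
      using lipschitz by (intro exI[of _ \<epsilon>]) (smt (verit) dist_real_def field_sum_of_halves zero_le_dist)
  qed
qed

lemma continuous_on_shrink: "continuous_on UNIV shrink"
proof -
  have "isCont shrink x" for x
  proof (cases "x = 0")
    \<comment> \<open>\<open>sgn\<close> jumps at \<open>0\<close>, so continuity there is obtained
      by squeezing with \<open>norm_shrink_le\<close>.\<close>
    case True
    have "(shrink \<longlongrightarrow> 0) (at 0)"
      by (rule tendsto_norm_zero_cancel,
          rule tendsto_sandwich[of "\<lambda>_. 0" _ _ norm])
        (auto intro!: always_eventually norm_shrink_le tendsto_norm_zero tendsto_ident_at)
    then show ?thesis
      using True by (simp add: isCont_def shrink_0)
  next
    case False
    have "isCont e x"
      using continuous_on_e by (meson UNIV_I continuous_on_eq_continuous_at open_UNIV)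
    with False show ?thesis
      unfolding shrink_def by (intro continuous_intros)
  qed
  then show ?thesis
    by (simp add: continuous_at_imp_continuous_on)
qed

text \<open>Directions are preserved, so points with equal images lie on one ray and satisfy
  \<open>dist x y = \<bar>e x - e y\<bar>\<close>, which is at most half of \<open>dist x y\<close>.
  Surjectivity is the intermediate value theorem on each ray.\<close>

lemma self_homeo_shrink: "self_homeo shrink"
  unfolding self_homeo_def
proof (intro conjI continuous_on_shrink bijI)
  show "inj shrink"
  proof (rule injI)
    fix x y
    assume eq: "shrink x = shrink y"
    show "x = y"
    proof (cases "x = 0 \<or> y = 0")
      case True
      then show ?thesis
        using eq shrink_eq_0_iff by metis
    next
      case False
      have sg: "sgn x = sgn y"
        using eq sgn_shrink by metis
      have "x = norm x *\<^sub>R sgn x" "y = norm y *\<^sub>R sgn y"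
        using False by (simp_all add: sgn_div_norm)
      then have "x - y = (norm x - norm y) *\<^sub>R sgn x"
        unfolding sg by (metis scaleR_left_diff_distrib)
      then have "dist x y = \<bar>norm x - norm y\<bar>"
        using False by (simp add: dist_norm norm_sgn)
      moreover have "norm x - e x = norm y - e y"
        using False norm_shrink eq by metis
      ultimately show ?thesis
        using lipschitz[of x y] by (smt (verit) field_sum_of_halves zero_le_dist dist_eq_0_iff)
    qed
  qed
  show "surj shrink"
  proof (rule surjI[of shrink "\<lambda>y. SOME x. shrink x = y"], rule someI_ex)
    fix y
    show "\<exists>x. shrink x = y"
    proof (cases "y = 0")
      case False
      let ?f = "\<lambda>a. a - e (a *\<^sub>R sgn y)"
      \<comment> \<open>The upper end \<open>2 * norm y\<close> comes from \<open>le_half\<close>: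
        at least half of the radius survives.\<close>
      have "\<exists>a\<ge>0. a \<le> 2 * norm y \<and> ?f a = norm y"
      proof (rule IVT')
        show "?f 0 \<le> norm y"
          by (simp add: zero)
        show "norm y \<le> ?f (2 * norm y)"
          using le_half[of "(2 * norm y) *\<^sub>R sgn y"] False by (simp add: norm_sgn)
        show "continuous_on {0..2 * norm y} ?f"
          by (intro continuous_intros continuous_on_compose2[OF continuous_on_e[of UNIV]]) auto
      qed simp
      then obtain a where a: "a \<ge> 0" "?f a = norm y"
        by blast
      have "a \<noteq> 0"
        using a False by (auto simp: zero)
      then have "shrink (a *\<^sub>R sgn y) = y"
        using a False by (simp add: shrink_eq_scaleR_sgn norm_sgn sgn_scaleR) (simp add: sgn_div_norm)
      then show ?thesis ..
    qed (auto intro: shrink_0)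
  qed
qed

lemma norm_iterate_mono: "m \<le> n \<Longrightarrow> norm ((shrink ^^ n) x) \<le> norm ((shrink ^^ m) x)"
  by (induction n rule: dec_induct) (auto intro: order_trans norm_shrink_le)

text \<open>On the compact shell between radii \<open>\<delta>\<close> and \<open>r\<close> the step
  length has a positive minimum \<open>\<mu>\<close>. An orbit loses at least \<open>\<mu>\<close>
  per step while it stays in the shell, and since norms never increase it cannot come back.\<close>

lemma iterate_uniformly_small:
  assumes "\<delta> > 0"
  obtains N where "\<And>m x. m \<ge> N \<Longrightarrow> norm x \<le> r \<Longrightarrow> norm ((shrink ^^ m) x) < \<delta>"
proof -
  have "\<exists>\<mu>>0. \<forall>x. \<delta> \<le> norm x \<and> norm x \<le> r \<longrightarrow> \<mu> \<le> e x"
  proof (cases "cball 0 r - ball (0::'a) \<delta> = {}")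
    case True
    then show ?thesis
      by (intro exI[of _ 1]) auto
  next
    case False
    obtain z where "z \<in> cball 0 r - ball 0 \<delta>" "\<And>x. x \<in> cball 0 r - ball 0 \<delta> \<Longrightarrow> e z \<le> e x"
      using continuous_attains_inf[OF _ False continuous_on_e] by (auto simp: compact_diff)
    then show ?thesis
      using pos[of z] \<open>\<delta> > 0\<close> by (intro exI[of _ "e z"]) force
  qed
  then obtain \<mu> where \<mu>: "\<mu> > 0" "\<And>x. \<delta> \<le> norm x \<Longrightarrow> norm x \<le> r \<Longrightarrow> \<mu> \<le> e x"
    by blast
  obtain N where N: "r / \<mu> < real N"
    using reals_Archimedean2 by blast
  have drop: "norm ((shrink ^^ m) x) \<le> norm x - real m * \<mu>"
    if "\<delta> \<le> norm ((shrink ^^ m) x)" "norm x \<le> r" for m x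
    using that(1)
  proof (induction m)
    case (Suc m)
    have le: "norm ((shrink ^^ Suc m) x) \<le> norm ((shrink ^^ m) x)" "norm ((shrink ^^ m) x) \<le> norm x"
      using norm_iterate_mono[of m "Suc m" x] norm_iterate_mono[of 0 m x] by auto
    have "norm (shrink ((shrink ^^ m) x)) = norm ((shrink ^^ m) x) - e ((shrink ^^ m) x)"
      using norm_shrink le Suc.prems \<open>\<delta> > 0\<close> by (metis norm_zero order_le_less_trans not_le order_trans)
    moreover have "\<mu> \<le> e ((shrink ^^ m) x)"
      using \<mu>(2) le Suc.prems that(2) by (meson order_trans)
    ultimately show ?case
      using Suc.IH le Suc.prems by (simp add: algebra_simps)
  qed simp
  show ?thesis
  proof (rule that, rule ccontr)
    fix m x
    assume m: "m \<ge> N" "norm x \<le> r" "\<not> norm ((shrink ^^ m) x) < \<delta>"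
    then have "norm ((shrink ^^ m) x) \<le> r - real m * \<mu>"
      using drop[of m x] by simp
    moreover have "r < real m * \<mu>"
      using N m(1) \<mu>(1) by (simp add: pos_divide_less_eq)
        (smt (verit) mult_right_mono of_nat_mono)
    ultimately show False
      by (smt (verit) norm_ge_zero)
  qed
qed

end

section \<open>Extending the conjugated map by the identity on \<open>X\<close>\<close>

text \<open>Bijectivity is checked separately on \<open>X\<close> and its complement. For continuity
  at a point of \<open>X\<close>, let \<open>y\<close> off \<open>X\<close> be close to it:
  \<open>F' y\<close> is near \<open>0\<close>, so \<open>F (s (F' y))\<close> is close to
  \<open>F (F' y) = y\<close>.\<close>

lemma homeomorphism_glue_id:
  fixes X :: "'a::euclidean_space set"
  assumes hom: "homeomorphism (- {0}) (- X) F F'" and X: "closed X"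
    and s: "self_homeo s" "s 0 = 0"
    and near: "\<And>\<delta>. \<delta> > 0 \<Longrightarrow> \<exists>U. open U \<and> X \<subseteq> U \<and> (\<forall>y\<in>U - X. norm (F' y) < \<delta>)"
    and small: "\<And>\<epsilon>. \<epsilon> > 0 \<Longrightarrow>
      \<exists>\<delta>>0. \<forall>x. x \<noteq> 0 \<and> norm x < \<delta> \<longrightarrow> dist (F (s x)) (F x) < \<epsilon>"
  shows "self_homeo (\<lambda>y. if y \<in> X then y else F (s (F' y)))" (is "self_homeo ?h")
  unfolding self_homeo_def
proof
  have bF: "bij_betw F (- {0}) (- X)" and bF': "bij_betw F' (- X) (- {0})"
    using hom unfolding homeomorphism_def
    by (auto intro!: bij_betw_byWitness[where f' = F'] bij_betw_byWitness[where f' = F])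
  have "bij_betw s (- {0}) (- {0})"
    using bij_betw_DiffI[OF self_homeo_bij[OF s(1)], of "{0}" "{0}"] s(2)
    by (simp add: Compl_eq_Diff_UNIV)
  then have "bij_betw (F \<circ> (s \<circ> F')) (- X) (- X)"
    by (intro bij_betw_trans[OF bij_betw_trans[OF bF'] bF])
  then have "bij_betw ?h (- X) (- X)"
    by (rule iffD1[OF bij_betw_cong, rotated]) simp
  moreover have "bij_betw ?h X X"
    using bij_betw_id by (rule iffD1[OF bij_betw_cong, rotated]) simp
  ultimately show "bij ?h"
    using bij_betw_combine[of ?h X X "- X" "- X"] by (simp add: Compl_partition)
  have s0: "s x \<noteq> 0" if "x \<noteq> 0" for x
    using that s by (metis self_homeo_bij bij_is_inj injD)
  have "F' y \<noteq> 0" if "y \<notin> X" for y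
    using that homeomorphism_image2[OF hom] by blast
  then have "continuous_on (- X) (\<lambda>y. F (s (F' y)))"
    using homeomorphism_cont2[OF hom] s0
    by (intro continuous_on_compose2[OF homeomorphism_cont1[OF hom]]
        continuous_on_compose2[OF self_homeo_continuous_on[OF s(1), of UNIV]]) auto
  then have "continuous_on (- X) ?h"
    by (rule continuous_on_eq) simp
  then have out: "isCont ?h y" if "y \<notin> X" for y
    using that X by (simp add: continuous_on_eq_continuous_at open_Compl)
  have inside: "isCont ?h x" if "x \<in> X" for x
    unfolding continuous_at_eps_delta
  proof (intro allI impI)
    fix \<epsilon> :: real
    assume "\<epsilon> > 0"
    then obtain \<delta> where \<delta>: "\<delta> > 0"
      "\<And>p. p \<noteq> 0 \<Longrightarrow> norm p < \<delta> \<Longrightarrow> dist (F (s p)) (F p) < \<epsilon> / 2"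
      using small[of "\<epsilon> / 2"] by auto
    obtain U where U: "open U" "X \<subseteq> U" "\<And>y. y \<in> U - X \<Longrightarrow> norm (F' y) < \<delta>"
      using near[OF \<delta>(1)] by blast
    obtain d where d: "d > 0" "ball x d \<subseteq> U"
      using U \<open>x \<in> X\<close> open_contains_ball by blast
    have "dist (?h y) (?h x) < \<epsilon>" if y: "dist y x < min d (\<epsilon> / 2)" for y
    proof (cases "y \<in> X")
      case False
      then have "y \<in> U - X"
        using d y by (auto simp: dist_commute subset_iff)
      moreover have "F' y \<noteq> 0" "F (F' y) = y"
        using False homeomorphism_image2[OF hom] homeomorphism_apply2[OF hom] by auto
      ultimately have "dist (?h y) y < \<epsilon> / 2"
        using \<delta>(2)[of "F' y"] U(3) False by simp
      then show ?thesis
        using y dist_triangle[of "?h y" x y] \<open>x \<in> X\<close> by simp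
    qed (use y \<open>x \<in> X\<close> \<open>\<epsilon> > 0\<close> in auto)
    then show "\<exists>d>0. \<forall>y. dist y x < d \<longrightarrow> dist (?h y) (?h x) < \<epsilon>"
      using d(1) \<open>\<epsilon> > 0\<close> by (intro exI[of _ "min d (\<epsilon> / 2)"]) auto
  qed
  show "continuous_on UNIV ?h"
    using out inside by (intro continuous_at_imp_continuous_on ballI) blast
qed

section \<open>Convergence in the semidistance\<close>

text \<open>Nonemptiness of \<open>X\<close> matters because \<open>infdist\<close> to the empty set
  is 0 by convention, whereas the infimum in \<open>semidist\<close> is then infinite.\<close>

lemma semidist_tendsto_0I:
  assumes "\<And>\<epsilon>. \<epsilon> > 0 \<Longrightarrow> \<exists>N. \<forall>m\<ge>N. \<forall>a\<in>A m. infdist a X < \<epsilon>" and "X \<noteq> {}"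
  shows "(\<lambda>m. semidist (A m) X) \<longlonglongrightarrow> 0"
proof (rule order_tendstoI)
  fix c :: ennreal
  assume "0 < c"
  \<comment> \<open>An intermediate value is finite, hence real, and leaves room for the supremum,
    which is bounded only non-strictly.\<close>
  then obtain c' where c': "0 < c'" "c' < c"
    using dense by blast
  define \<epsilon> where "\<epsilon> = enn2real c'"
  have "c' < top"
    using c'(2) top_greatest by (rule less_le_trans)
  then have \<epsilon>: "\<epsilon> > 0" "ennreal \<epsilon> < c"
    using c' by (simp_all add: \<epsilon>_def enn2real_positive_iff ennreal_enn2real)
  obtain N where N: "\<And>m a. m \<ge> N \<Longrightarrow> a \<in> A m \<Longrightarrow> infdist a X < \<epsilon>"
    using assms(1)[OF \<epsilon>(1)] by blast
  have "semidist (A m) X \<le> ennreal \<epsilon>" if "m \<ge> N" for m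
    unfolding semidist_def
  proof (rule SUP_least)
    fix a
    assume "a \<in> A m"
    then have "infdist a X < \<epsilon>"
      using N that by blast
    then obtain b where "b \<in> X" "dist a b < \<epsilon>"
      using assms(2) by (auto simp: infdist_def cINF_less_iff)
    then show "(INF b\<in>X. ennreal (dist a b)) \<le> ennreal \<epsilon>"
      by (intro INF_lower2[of b]) (auto intro: ennreal_leI)
  qed
  then show "\<forall>\<^sub>F m in sequentially. semidist (A m) X < c"
    using \<epsilon>(2) by (auto simp: eventually_sequentially intro: le_less_trans)
qed simp

section \<open>Choice of the step length and the attracting homeomorphism\<close>

text \<open>The gap between \<open>R0\<close> and \<open>R\<close> yields the uniform
  \<open>\<rho>\<close>: \<open>F\<close> is the identity beyond \<open>R0\<close>, and
  \<open>e\<close> is bounded below beyond the midpoint of \<open>R0\<close> and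
  \<open>R\<close>.\<close>

lemma cellular_attracting_homeomorphism:
  fixes X :: "'a::euclidean_space set"
  assumes X: "cellular X" and XR: "X \<subseteq> ball 0 R0" and "R0 < R"
  obtains h \<rho> where "self_homeo h" "\<And>x. x \<in> X \<Longrightarrow> h x = x" "global_attractor h X"
    "\<rho> > 0" "\<And>r. r \<ge> R \<Longrightarrow> h ` ball 0 r \<subseteq> ball 0 (r - \<rho>)"
proof -
  have X0: "X \<noteq> {}" and cX: "compact X"
    using X by (rule cellular_nonempty, rule cellular_compact)
  have R0: "R0 > 0"
    using XR X0 by (metis ball_empty linorder_not_le subset_empty)
  obtain F F' where hom: "homeomorphism (- {0}) (- X) F F'"
    and FR: "\<And>x. norm x \<ge> R0 \<Longrightarrow> F x = x"
    and FX: "\<And>\<epsilon>. \<epsilon> > 0 \<Longrightarrow> \<exists>\<delta>>0. \<forall>x. x \<noteq> 0 \<and> norm x < \<delta> \<longrightarrow> infdist (F x) X < \<epsilon>"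
    and F'X: "\<And>\<delta>. \<delta> > 0 \<Longrightarrow> \<exists>U. open U \<and> X \<subseteq> U \<and> (\<forall>y\<in>U - X. norm (F' y) < \<delta>)"
    using cellular_complement_homeomorphism[OF X XR] by blast
  have F': "F' y \<noteq> 0" "F (F' y) = y" if "y \<notin> X" for y
    using that homeomorphism_image2[OF hom] homeomorphism_apply2[OF hom] by auto
  have FnX: "F x \<notin> X" "F' (F x) = x" if "x \<noteq> 0" for x
    using that homeomorphism_image1[OF hom] homeomorphism_apply1[OF hom] by auto
  txt \<open>The map \<open>shrink\<close> must move \<open>p\<close> so little that \<open>F p\<close> moves by less than \<open>\<bar>p\<bar>\<close>. The distance of \<open>(p, p)\<close>
    to the set of pairs violating this is a Lipschitz choice of step size. The pair \<open>(0, 0)\<close>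
    ensures \<open>e p \<le> \<bar>p\<bar> / 2\<close>, and the restriction \<open>\<bar>p\<bar> \<le> R0\<close> bounds \<open>e\<close> from below far away.\<close>
  define Bad where "Bad = insert (0, 0)
    {(p, q). p \<noteq> 0 \<and> q \<noteq> 0 \<and> norm p \<le> R0 \<and> norm p \<le> dist (F p) (F q)}"
  have infdist_Bad_ge: "c \<le> infdist z Bad" if "\<And>w. w \<in> Bad \<Longrightarrow> c \<le> dist z w" for c z
  proof -
    have "Bad \<noteq> {}"
      by (simp add: Bad_def)
    then show ?thesis
      using that by (simp add: infdist_notempty cINF_greatest)
  qed
  \<comment> \<open>Dividing by 4 offsets the factor 2 of \<open>dist_diag\<close>, giving Lipschitz
    constant 1/2, and keeps \<open>e x\<close> strictly below the distance to \<open>Bad\<close>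
    when \<open>x\<close> is nonzero.\<close>
  define e where "e = (\<lambda>x. infdist (x, x) Bad / 4)"
  have dist_diag: "dist (x, x) (y, y) \<le> 2 * dist x y" for x y :: 'a
    using sqrt_sum_squares_le_sum_abs[of "dist x y" "dist x y"] by (simp add: dist_Pair_Pair)
  interpret radial_contraction e
  proof
    fix x y :: 'a
    show "\<bar>e x - e y\<bar> \<le> dist x y / 2"
      using infdist_triangle_abs[of "(x, x)" Bad "(y, y)"] dist_diag[of x y]
      unfolding e_def by linarith
    show "e x \<le> norm x / 2"
      using infdist_le[of "(0, 0)" Bad "(x, x)"] dist_diag[of x 0] by (simp add: e_def Bad_def)
    show "e 0 = 0"
      by (simp add: e_def Bad_def)
    assume "x \<noteq> 0"
    have "isCont F x"
      using homeomorphism_cont1[OF hom] \<open>x \<noteq> 0\<close>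
      by (simp add: continuous_on_eq_continuous_at open_Compl)
    then obtain d0 where d0: "d0 > 0" "\<And>p. dist p x < d0 \<Longrightarrow> dist (F p) (F x) < norm x / 4"
      using \<open>x \<noteq> 0\<close> unfolding continuous_at_eps_delta
      by (metis divide_pos_pos zero_less_norm_iff zero_less_numeral)
    define d where "d = min d0 (norm x / 2)"
    \<comment> \<open>If \<open>p\<close> and \<open>q\<close> are both close to \<open>x\<close>,
      continuity puts \<open>F p\<close> and \<open>F q\<close> within \<open>norm x / 2\<close> of
      each other, while \<open>norm p\<close> exceeds \<open>norm x / 2\<close>; such a pair is not
      bad.\<close>
    have "d \<le> dist (x, x) z" if "z \<in> Bad" for z
    proof (rule ccontr)
      assume *: "\<not> d \<le> dist (x, x) z"
      obtain p q where z: "z = (p, q)" by fastforce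
      have pq: "dist p x < d" "dist q x < d"
        using * z dist_fst_le[of "(x, x)" z] dist_snd_le[of "(x, x)" z] by (auto simp: dist_commute)
      then have "norm x / 2 < norm p"
        using norm_triangle_ineq2[of x p] by (simp add: d_def dist_norm norm_minus_commute)
      moreover have "dist (F p) (F q) < norm x / 4 + norm x / 4"
        using d0(2)[of p] d0(2)[of q] pq dist_triangle2[of "F p" "F q" "F x"] by (simp add: d_def)
      ultimately show False
        using that z by (auto simp: Bad_def)
    qed
    then have "d \<le> infdist (x, x) Bad"
      by (rule infdist_Bad_ge)
    moreover have "0 < d"
      using d0(1) \<open>x \<noteq> 0\<close> by (simp add: d_def)
    ultimately show "0 < e x"
      by (simp add: e_def)
  qed
  \<comment> \<open>Otherwise \<open>(x, shrink x)\<close> would be a bad pair at distance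
    \<open>e x\<close> from \<open>(x, x)\<close>, although every bad pair is at distance at least
    \<open>4 * e x\<close>.\<close>
  have good: "dist (F (shrink x)) (F x) < norm x" if "x \<noteq> 0" "norm x \<le> R0" for x
  proof (rule ccontr)
    assume "\<not> dist (F (shrink x)) (F x) < norm x"
    then have "(x, shrink x) \<in> Bad"
      using that shrink_eq_0_iff[of x] by (simp add: Bad_def dist_commute)
    then have "infdist (x, x) Bad \<le> dist (x, x) (x, shrink x)"
      by (rule infdist_le)
    also have "\<dots> = e x"
      using dist_shrink[OF that(1)] pos[OF that(1)] by (simp add: dist_Pair_Pair)
    finally show False
      using pos[OF that(1)] by (simp add: e_def)
  qed
  define h where "h = (\<lambda>y. if y \<in> X then y else F (shrink (F' y)))"
  have h: "self_homeo h"
    unfolding h_def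
  proof (rule homeomorphism_glue_id[OF hom compact_imp_closed[OF cX] self_homeo_shrink shrink_0 F'X])
    fix \<epsilon> :: real
    assume "\<epsilon> > 0"
    then show "\<exists>\<delta>>0. \<forall>x. x \<noteq> 0 \<and> norm x < \<delta> \<longrightarrow> dist (F (shrink x)) (F x) < \<epsilon>"
      using good R0 by (intro exI[of _ "min \<epsilon> R0"]) fastforce
  qed
  have iter: "(h ^^ m) y = F ((shrink ^^ m) (F' y)) \<and> (shrink ^^ m) (F' y) \<noteq> 0" if "y \<notin> X" for m y
  proof (induction m)
    case (Suc m)
    then show ?case
      using FnX[of "(shrink ^^ m) (F' y)"] shrink_eq_0_iff by (simp add: h_def)
  qed (use F' that in simp)
  have iterX: "(h ^^ m) y = y" if "y \<in> X" for m y
    by (induction m) (use that in \<open>simp_all add: h_def\<close>)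
  have "(\<lambda>m. semidist ((h ^^ m) ` B) X) \<longlonglongrightarrow> 0" if "bounded B" for B
  proof (rule semidist_tendsto_0I[OF _ X0])
    fix \<epsilon> :: real
    assume "\<epsilon> > 0"
    obtain b where b: "\<And>y. y \<in> B \<Longrightarrow> norm y \<le> b"
      using \<open>bounded B\<close> unfolding bounded_iff by blast
    obtain \<delta> where \<delta>: "\<delta> > 0" "\<And>x. x \<noteq> 0 \<Longrightarrow> norm x < \<delta> \<Longrightarrow> infdist (F x) X < \<epsilon>"
      using FX[OF \<open>\<epsilon> > 0\<close>] by blast
    obtain N where N: "\<And>m x. m \<ge> N \<Longrightarrow> norm x \<le> max R0 b \<Longrightarrow> norm ((shrink ^^ m) x) < \<delta>"
      using iterate_uniformly_small[OF \<delta>(1)] by blast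
    have "infdist ((h ^^ m) y) X < \<epsilon>" if "m \<ge> N" "y \<in> B" for m y
    proof (cases "y \<in> X")
      case True
      then show ?thesis
        using iterX \<open>\<epsilon> > 0\<close> by simp
    next
      case False
      \<comment> \<open>If \<open>F' y\<close> has norm at least \<open>R0\<close>, then
        \<open>F\<close> fixes it and it equals \<open>y\<close>.\<close>
      have "norm (F' y) \<le> max R0 b"
        using FR[of "F' y"] F'(2)[OF False] b[OF that(2)] by (cases "norm (F' y) \<ge> R0") auto
      then show ?thesis
        using \<delta>(2) N[OF that(1)] iter[OF False] by simp
    qed
    then show "\<exists>N. \<forall>m\<ge>N. \<forall>a\<in>(h ^^ m) ` B. infdist a X < \<epsilon>"
      by blast
  qed
  moreover have "h ` X = X"
    by (simp add: h_def)
  ultimately have "global_attractor h X"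
    unfolding global_attractor_def using cX self_homeo_continuous_on[OF h] by blast
  \<comment> \<open>Beyond the midpoint the distance to \<open>Bad\<close> is at least
    \<open>(R - R0) / 2\<close>; the factor 1/4 in \<open>e\<close> turns this into
    \<open>\<rho>\<close>.\<close>
  define \<rho> where "\<rho> = (R - R0) / 8"
  have \<rho>: "\<rho> > 0"
    using \<open>R0 < R\<close> by (simp add: \<rho>_def)
  have e_ge: "\<rho> \<le> e x" if x: "norm x \<ge> (R0 + R) / 2" for x
  proof -
    have "(R - R0) / 2 \<le> dist (x, x) z" if "z \<in> Bad" for z
    proof -
      have "norm (fst z) \<le> R0"
        using that R0 by (auto simp: Bad_def)
      moreover have "dist x (fst z) \<le> dist (x, x) z"
        using dist_fst_le[of "(x, x)" z] by simp
      ultimately show ?thesis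
        using x norm_triangle_ineq2[of x "fst z"] by (simp add: dist_norm field_simps)
    qed
    then have "(R - R0) / 2 \<le> infdist (x, x) Bad"
      by (rule infdist_Bad_ge)
    then show ?thesis
      by (simp add: e_def \<rho>_def)
  qed
  \<comment> \<open>If \<open>F x\<close> had norm at least \<open>R0\<close>, it would be fixed by
    \<open>F\<close>, and injectivity would give \<open>F x = x\<close>.\<close>
  have Fsmall: "norm (F x) < R0" if "x \<noteq> 0" "norm x < R0" for x
    using that FR[of "F x"] FnX[of x] FnX[of "F x"] R0
    by (smt (verit) norm_zero)
  show ?thesis
  proof (rule that[OF h _ \<open>global_attractor h X\<close> \<rho>])
    show "h x = x" if "x \<in> X" for x
      using that by (simp add: h_def)
    fix r
    assume "r \<ge> R"
    then have r: "R0 < r - \<rho>"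
      using \<open>R0 < R\<close> by (simp add: \<rho>_def field_simps)
    have "norm (h y) < r - \<rho>" if "norm y < r" for y
    proof (cases "y \<in> X")
      case True
      then have "norm y < R0" "h y = y"
        using XR by (auto simp: h_def)
      then show ?thesis
        using r by simp
    next
      case False
      define p where "p = F' y"
      have p: "p \<noteq> 0" "F p = y" "h y = F (shrink p)"
        using F'[OF False] False by (auto simp: p_def h_def)
      show ?thesis
      \<comment> \<open>Either \<open>h y\<close> stays in the ball of radius \<open>R0\<close>, or
        \<open>F\<close> fixes both \<open>p\<close> and \<open>shrink p\<close>. In the latter case
        the step is at least \<open>\<rho>\<close>, or \<open>p\<close> lies below the midpoint,
        which is \<open>R - 4 * \<rho>\<close>.\<close>
      proof (cases "norm (shrink p) < R0")
        case True
        then have "norm (h y) < R0"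
          using Fsmall[of "shrink p"] p shrink_eq_0_iff by simp
        then show ?thesis
          using r by simp
      next
        case False
        then have "y = p" "h y = shrink p"
          using FR norm_shrink_le[of p] p by auto
        then show ?thesis
          using norm_shrink[OF p(1)] e_ge[of p] pos[OF p(1)] \<open>norm y < r\<close> \<open>r \<ge> R\<close> \<open>R0 < R\<close>
          by (cases "norm p \<ge> (R0 + R) / 2") (simp_all add: \<rho>_def field_simps)
      qed
    qed
    then show "h ` ball 0 r \<subseteq> ball 0 (r - \<rho>)"
      by auto
  qed
qed

theorem theorem2p4:
  fixes X :: "(real ^ 'n) set" and R :: real
  assumes "cellular X"
  shows "\<exists>h :: real ^ 'n \<Rightarrow> real ^ 'n.
           (\<exists>g. homeomorphism UNIV UNIV h g) \<and>
           (\<forall>x\<in>X. h x = x) \<and>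
           global_attractor h X \<and>
           (X \<subseteq> ball 0 R \<longrightarrow>
              (\<exists>\<rho>>0. \<forall>r\<ge>R. h ` ball 0 r \<subseteq> ball 0 (r - \<rho>)))"
proof -
  obtain z where z: "\<And>x. x \<in> X \<Longrightarrow> norm x \<le> norm z" "z \<in> X"
    using continuous_attains_sup[OF cellular_compact[OF assms] cellular_nonempty[OF assms]
        continuous_on_norm_id] by auto
  \<comment> \<open>The homeomorphism must exist even if \<open>X\<close> is not inside the ball of
    radius \<open>R\<close>; the fallback is any radius exceeding \<open>norm z\<close>.\<close>
  define R1 where "R1 = (if X \<subseteq> ball 0 R then R else norm z + 1)"
  have R1: "norm z < R1"
    using z(2) by (auto simp: R1_def)
  \<comment> \<open>The maximal norm on the compact set \<open>X\<close> is attained and lies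
    strictly below \<open>R1\<close>, so a radius fits strictly in between.\<close>
  define R0 where "R0 = (norm z + R1) / 2"
  have "X \<subseteq> ball 0 R0" "R0 < R1"
    using R1 z(1) by (fastforce simp: R0_def)+
  then obtain h \<rho> where h: "self_homeo h" "\<And>x. x \<in> X \<Longrightarrow> h x = x" "global_attractor h X"
    and \<rho>: "\<rho> > 0" "\<And>r. r \<ge> R1 \<Longrightarrow> h ` ball 0 r \<subseteq> ball 0 (r - \<rho>)"
    using cellular_attracting_homeomorphism[OF assms] by metis
  have "\<exists>\<rho>>0. \<forall>r\<ge>R. h ` ball 0 r \<subseteq> ball 0 (r - \<rho>)" if "X \<subseteq> ball 0 R"
    using \<rho> that by (auto simp: R1_def)
  then show ?thesis
    using h self_homeo_homeomorphism by blast
qed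

end
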